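(* Let $X=\mathbb P^1$, $G=SL_2$. Given a positive integer $d$, one has $\mathcal N(\delta)\ne\emptyset$ for every $\delta\in\mathbb C[\partial]_d$.
   Context: Here $V^\vee=\Gamma(\mathbb P^1,K^{-1})$ is the space of binary quadratic forms $a_0x_1x_2+a_1x_1^2+a_2x_2^2$, with linear coordinates $a_0,a_1,a_2$ and $\partial_i=\partial/\partial a_i$. $\mathbb C[\partial]=\mathbb C[\partial_0,\partial_1,\partial_2]$ is the ring of constant coefficient differential operators and $\mathbb C[\partial]_d$ its homogeneous part of degree $d$. $B\subset V^\vee$ is the set of forms with two distinct zeros in $\mathbb P^1$, i.e. $B=\{a_0^2-4a_1a_2\neq0\}$. The tautological system $\tau$ on $V^\vee$ is the $D$-module whose solution sheaf $\mathrm{sol}(\tau)$ consists of holomorphic functions $s$ satisfying: $(\partial_0^2-\partial_1\partial_2)s=0$; $s$ is annihilated by the vector fields of the $\mathfrak{sl}_2$-action, namely $-2a_1\partial_1+2a_2\partial_2$, $-2a_2\partial_0-a_0\partial_1$, $-2a_1\partial_0-a_0\partial_2$; and $(a_0\partial_0+a_1\partial_1+a_2\partial_2+1)s=0$. For $\delta\in\mathbb C[\partial]$, $\mathcal N(\delta)=\{b\in B\mid\delta s(b)=0\ \ \forall s\in\mathrm{sol}(\tau)_b\}$. *)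

theory Defs
  imports "HOL-Analysis.Analysis" "HOL-Library.Poly_Mapping"
begin

text \<open>
  A vector \<open>a :: complex ^ 3\<close> stands for the binary quadratic form
  \<open>(a $ 0) x\<^sub>1 x\<^sub>2 + (a $ 1) x\<^sub>1\<^sup>2 + (a $ 2) x\<^sub>2\<^sup>2\<close>; the index type \<open>3\<close> has exactly the
  elements \<open>0\<close>, \<open>1\<close>, \<open>2\<close>.
\<close>

type_synonym form = "complex ^ 3"

definition B :: "form set" where
  "B = {a. (a $ 0)\<^sup>2 - 4 * (a $ 1) * (a $ 2) \<noteq> 0}"

definition holo_on :: "(form \<Rightarrow> complex) \<Rightarrow> form set \<Rightarrow> bool" where
  "holo_on s U \<longleftrightarrow>
     (\<forall>a\<in>U. \<exists>L. (s has_derivative L) (at a) \<and> (\<forall>c v. L (c *s v) = c * L v))"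

definition pd :: "3 \<Rightarrow> (form \<Rightarrow> complex) \<Rightarrow> form \<Rightarrow> complex" where
  "pd i s = (\<lambda>a. deriv (\<lambda>z. s (a + axis i z)) 0)"

text \<open>
  The polynomial ring in \<open>\<partial>\<^sub>0, \<partial>\<^sub>1, \<partial>\<^sub>2\<close>: a key \<open>m\<close> is the exponent vector of the monomial
  \<open>\<partial>\<^sub>0\<^bsup>m 0\<^esup> \<partial>\<^sub>1\<^bsup>m 1\<^esup> \<partial>\<^sub>2\<^bsup>m 2\<^esup>\<close>.
\<close>

type_synonym diffop = "(3 \<Rightarrow>\<^sub>0 nat) \<Rightarrow>\<^sub>0 complex"

definition homogeneous_ops :: "nat \<Rightarrow> diffop set" where
  "homogeneous_ops d =
     {\<delta>. \<forall>m \<in> Poly_Mapping.keys \<delta>. (\<Sum>i\<in>UNIV. Poly_Mapping.lookup m i) = d}"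

definition monomial_op :: "(3 \<Rightarrow>\<^sub>0 nat) \<Rightarrow> (form \<Rightarrow> complex) \<Rightarrow> form \<Rightarrow> complex" where
  "monomial_op m s =
     (pd 0 ^^ Poly_Mapping.lookup m 0)
       ((pd 1 ^^ Poly_Mapping.lookup m 1)
         ((pd 2 ^^ Poly_Mapping.lookup m 2) s))"

definition apply_op :: "diffop \<Rightarrow> (form \<Rightarrow> complex) \<Rightarrow> form \<Rightarrow> complex" where
  "apply_op \<delta> s =
     (\<lambda>a. \<Sum>m \<in> Poly_Mapping.keys \<delta>. Poly_Mapping.lookup \<delta> m * monomial_op m s a)"

definition sol :: "form set \<Rightarrow> (form \<Rightarrow> complex) set" where
  "sol U = {s. holo_on s U \<and> (\<forall>a\<in>U.
     pd 0 (pd 0 s) a - pd 1 (pd 2 s) a = 0 \<and>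
     - 2 * (a $ 1) * pd 1 s a + 2 * (a $ 2) * pd 2 s a = 0 \<and>
     - 2 * (a $ 2) * pd 0 s a - (a $ 0) * pd 1 s a = 0 \<and>
     - 2 * (a $ 1) * pd 0 s a - (a $ 0) * pd 2 s a = 0 \<and>
     (a $ 0) * pd 0 s a + (a $ 1) * pd 1 s a + (a $ 2) * pd 2 s a + s a = 0)}"

text \<open>
  Representatives of the germs in the stalk of the solution sheaf at \<open>b\<close>. Values of \<open>s\<close> away
  from the neighbourhood \<open>U\<close> are irrelevant, since \<open>pd\<close> and \<open>apply_op\<close> at \<open>b\<close> only depend on
  the germ of \<open>s\<close> at \<open>b\<close>.
\<close>

definition sol_stalk :: "form \<Rightarrow> (form \<Rightarrow> complex) set" where
  "sol_stalk b = {s. \<exists>U. open U \<and> b \<in> U \<and> s \<in> sol U}"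

definition zero_locus :: "diffop \<Rightarrow> form set" where
  "zero_locus \<delta> = {b \<in> B. \<forall>s \<in> sol_stalk b. apply_op \<delta> s b = 0}"

end

theory Submission
  imports Defs "HOL-Complex_Analysis.Cauchy_Integral_Formula"
begin

text \<open>
  Put \<open>D = a\<^sub>0\<^sup>2 - 4 a\<^sub>1 a\<^sub>2\<close> and \<open>Q = a\<^sub>0 t - a\<^sub>2 - a\<^sub>1 t\<^sup>2\<close>. The first-order equations give
  \<open>D \<partial>\<^sub>i s = g\<^sub>i s\<close> with \<open>g = (- a\<^sub>0, 2 a\<^sub>2, 2 a\<^sub>1)\<close>, so locally \<open>s\<close> is a multiple of \<open>D\<^bsup>-1/2\<^esup>\<close>.
  A monomial of degree \<open>d\<close> with exponents \<open>(m\<^sub>0, m\<^sub>1, m\<^sub>2)\<close> sends \<open>s\<close> to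
  \<open>(-1)\<^sup>d e! (2d - e)! / d! \<cdot> [t\<^sup>e] Q\<^sup>d \<cdot> s / D\<^sup>d\<close>, where \<open>e = m\<^sub>0 + 2 m\<^sub>2\<close>. It remains to find a form in \<open>B\<close>
  at which a given linear combination of the coefficients \<open>[t\<^sup>e] Q\<^sup>d\<close>, \<open>e \<le> 2d\<close>, vanishes.
  If some \<open>e > d\<close> (resp. \<open>e < d\<close>) occurs, the combination is a nonconstant polynomial on the line
  \<open>(1, x, 0)\<close> (resp. \<open>(1, 0, x)\<close>), which lies in \<open>B\<close>. Otherwise only \<open>[t\<^sup>d] Q\<^sup>d\<close> occurs: on the line
  \<open>(x, 1, 1)\<close> it has degree \<open>d\<close> in \<open>x\<close>, and it does not vanish at \<open>x = \<plusminus>2\<close>, where \<open>- Q\<close> is a square.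
\<close>

section \<open>Differential identities for powers of \<open>Q\<close>\<close>

definition qpoly :: "form \<Rightarrow> complex poly" where
  "qpoly a = [:- (a $ 2), a $ 0, - (a $ 1):]"

definition disc :: "form \<Rightarrow> complex" where
  "disc a = (a $ 0)\<^sup>2 - 4 * (a $ 1) * (a $ 2)"

text \<open>As \<open>Q\<close> is quadratic in \<open>t\<close>, \<open>Q'^2 - 2 Q Q''\<close> is
  constant in \<open>t\<close>. Writing the scalars through \<open>Q\<close>, \<open>Q'\<close>,
  \<open>Q''\<close> makes the identities for \<open>Q^d\<close> purely algebraic.\<close>

lemma qpoly_derivs:
  fixes a :: form
  defines "Q \<equiv> qpoly a"
  defines "Q' \<equiv> pderiv Q"
  defines "Q'' \<equiv> pderiv Q'"
  shows "[:disc a:] = Q' * Q' - 2 * Q * Q''"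
    and "[:a $ 0:] = Q' - [:0, 1:] * Q''"
    and "[:2 * a $ 2:] = 2 * [:0, 1:] * Q' - [:0, 1:] * [:0, 1:] * Q'' - 2 * Q"
    and "[:2 * a $ 1:] = - Q''"
  unfolding Q_def Q'_def Q''_def qpoly_def disc_def
  by (simp_all add: pderiv_pCons power2_eq_square algebra_simps numeral_poly)

lemma pderiv_power_of_nat:
  fixes p :: "'a :: idom poly"
  shows "pderiv (p ^ Suc n) = of_nat (Suc n) * p ^ n * pderiv p"
    and "pderiv (pderiv (p ^ Suc n)) =
      of_nat (Suc n) * (of_nat n * p ^ (n - 1) * pderiv p * pderiv p + p ^ n * pderiv (pderiv p))"
proof -
  show 1: "pderiv (p ^ Suc n) = of_nat (Suc n) * p ^ n * pderiv p" for n
    by (simp add: pderiv_power_Suc of_nat_poly del: power_Suc of_nat_Suc)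
  show "pderiv (pderiv (p ^ Suc n)) =
      of_nat (Suc n) * (of_nat n * p ^ (n - 1) * pderiv p * pderiv p + p ^ n * pderiv (pderiv p))"
  proof (cases n)
    case (Suc k)
    then show ?thesis
      by (simp add: 1 pderiv_mult algebra_simps del: power_Suc of_nat_Suc)
  qed (simp add: 1)
qed

text \<open>Differentiating \<open>Q^d s / D^d\<close> along axis \<open>i\<close> gives
  \<open>s / D^(d+1)\<close> times the factor that \<open>Suc d\<close> multiplies on the left. In
  terms of \<open>H\<close> this becomes an operator in \<open>t\<close> that shifts all exponents
  by the same amount.\<close>

lemma qpoly_power_ode:
  fixes a :: form and d :: nat
  defines "Q \<equiv> qpoly a" and "X \<equiv> [:0, 1:] :: complex poly"
  defines "H \<equiv> Q ^ Suc d"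
  shows "of_nat (Suc d) * ([:disc a:] * of_nat d * (Q ^ (d - 1) * X) - of_nat (2 * d + 1) * [:a $ 0:] * Q ^ d)
           = X * pderiv (pderiv H) - of_nat (2 * d + 1) * pderiv H" (is ?t0)
    and "of_nat (Suc d) * ([:disc a:] * of_nat d * (Q ^ (d - 1) * - (X * X)) + of_nat (2 * d + 1) * [:2 * a $ 2:] * Q ^ d)
           = - (of_nat (2 * d + 2) * of_nat (2 * d + 1) * H - 2 * of_nat (2 * d + 1) * X * pderiv H
               + X * X * pderiv (pderiv H))" (is ?t1)
    and "of_nat (Suc d) * ([:disc a:] * of_nat d * (Q ^ (d - 1) * - 1) + of_nat (2 * d + 1) * [:2 * a $ 1:] * Q ^ d)
           = - pderiv (pderiv H)" (is ?t2)
proof -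
  define R S N Q' Q'' where "R = Q ^ (d - 1)" and "S = Q ^ d" and "N = (of_nat d :: complex poly)"
    and "Q' = pderiv Q" and "Q'' = pderiv Q'"
  \<comment> \<open>For \<open>d = 0\<close> the exponent \<open>d - 1\<close> truncates and
    \<open>S = Q * R\<close> may fail; the factor \<open>N\<close> repairs this.\<close>
  have *: "N * S = N * Q * R"
    unfolding N_def S_def R_def by (cases d) simp_all
  have H: "H = Q * S" "pderiv H = (N + 1) * S * Q'"
      "pderiv (pderiv H) = (N + 1) * (N * R * Q' * Q' + S * Q'')"
    using pderiv_power_of_nat[of Q d]
    by (simp_all add: H_def R_def S_def N_def Q'_def Q''_def add.commute del: mult_eq_0_iff)
  have N: "of_nat (Suc d) = N + 1" "of_nat (2 * d + 1) = 2 * N + 1" "of_nat (2 * d + 2) = 2 * N + 2"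
    by (simp_all add: N_def)
  note rw = N qpoly_derivs[of a, folded Q_def Q'_def, folded Q''_def, folded X_def]
    R_def[symmetric] S_def[symmetric] N_def[symmetric]
  show ?t0 unfolding H(3) unfolding H(2) unfolding H(1) rw using * by algebra
  show ?t1 unfolding H(3) unfolding H(2) unfolding H(1) rw using * by algebra
  show ?t2 unfolding H(3) unfolding H(2) unfolding H(1) rw using * by algebra
qed

section \<open>Numerators of iterated derivatives\<close>

text \<open>A grading in which \<open>\<partial>\<^sub>0\<^sup>2\<close> and
  \<open>\<partial>\<^sub>1 \<partial>\<^sub>2\<close> have equal weight.\<close>

definition weight :: "3 \<Rightarrow> nat" where
  "weight i = (if i = 0 then 1 else if i = 1 then 0 else 2)"

text \<open>Minus half the gradient of \<open>disc\<close>, as befits the logarithmic derivative of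
  \<open>disc^(-1/2)\<close>.\<close>

definition log_deriv_numerator :: "3 \<Rightarrow> form \<Rightarrow> complex" where
  "log_deriv_numerator i a = (if i = 0 then - (a $ 0) else if i = 1 then 2 * a $ 2 else 2 * a $ 1)"

text \<open>
  The vector \<open>v = (2t, 1, t\<^sup>2)\<close> is isotropic for \<open>D\<close>, whence \<open>(v \<cdot> \<partial>)\<^sup>d D\<^bsup>-1/2\<^esup>\<close> is a constant times
  \<open>Q\<^sup>d D\<^bsup>-1/2-d\<^esup>\<close>; modulo \<open>\<partial>\<^sub>0\<^sup>2 - \<partial>\<^sub>1 \<partial>\<^sub>2\<close> the coefficient of \<open>t\<^sup>e\<close> in \<open>(v \<cdot> \<partial>)\<^sup>d\<close> is \<open>2d choose e\<close>
  times any monomial of weight \<open>e\<close>. This is the source of the factorials.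
\<close>

definition deriv_numerator :: "nat \<Rightarrow> nat \<Rightarrow> form \<Rightarrow> complex" where
  "deriv_numerator d e a = (-1) ^ d * fact e * fact (2 * d - e) / fact d * coeff (qpoly a ^ d) e"

lemma index3_cases: "(i :: 3) = 0 \<or> i = 1 \<or> i = 2"
  using exhaust_3[of i] by auto

lemma sum_UNIV_index3: "sum f (UNIV :: 3 set) = f 0 + f 1 + f 2"
proof -
  have "(UNIV :: 3 set) = {0, 1, 2}"
    using index3_cases by auto
  then have "sum f (UNIV :: 3 set) = sum f {0, 1, 2}" by (rule arg_cong)
  then show ?thesis by (simp add: add.assoc)
qed

lemma qpoly_axis:
  "qpoly (axis 0 1) = [:0, 1:]" "qpoly (axis 1 1) = - ([:0, 1:] * [:0, 1:])" "qpoly (axis 2 1) = - 1"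
  by (simp_all add: qpoly_def axis_def one_pCons)

lemma coeff_of_nat_mult: "coeff (of_nat k * p) n = of_nat k * coeff p n"
  by (simp add: of_nat_poly)

lemma coeff_X_mult_pderiv: "coeff ([:0, 1:] * pderiv p) n = of_nat n * coeff p n"
  by (cases n) (simp_all add: coeff_pderiv)

lemma coeff_X_sq_mult_pderiv2:
  fixes p :: "'a :: idom poly"
  shows "coeff ([:0, 1:] * [:0, 1:] * pderiv (pderiv p)) n = of_nat n * (of_nat n - 1) * coeff p n"
  by (cases n; cases "n - 1") (simp_all add: coeff_pderiv algebra_simps)

text \<open>Since each operator in \<open>qpoly_power_ode\<close> shifts exponents uniformly, its
  coefficient at \<open>e\<close> involves a single coefficient of \<open>Q^(d+1)\<close>, with a
  scalar that factors.\<close>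

lemma coeff_qpoly_power_rec:
  fixes a :: form
  assumes e: "e \<le> 2 * d"
  defines "c \<equiv> \<lambda>i. of_nat (Suc d) * (disc a * of_nat d * coeff (qpoly a ^ (d - 1) * qpoly (axis i 1)) e
                 + of_nat (2 * d + 1) * log_deriv_numerator i a * coeff (qpoly a ^ d) e)"
  shows "c 0 = - of_nat (Suc e) * of_nat (2 * d + 1 - e) * coeff (qpoly a ^ Suc d) (Suc e)"
    and "c 1 = - of_nat (2 * d + 2 - e) * of_nat (2 * d + 1 - e) * coeff (qpoly a ^ Suc d) e"
    and "c 2 = - of_nat (Suc e) * of_nat (Suc (Suc e)) * coeff (qpoly a ^ Suc d) (Suc (Suc e))"
proof -
  note ode = qpoly_power_ode[of d a, THEN arg_cong[where f = "\<lambda>p. coeff p e"]]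
  define H where "H = qpoly a ^ Suc d"
  have k: "of_nat (2 * d + 1 - e) = (of_nat (2 * d + 1) - of_nat e :: complex)"
     "of_nat (2 * d + 2 - e) = (of_nat (2 * d + 2) - of_nat e :: complex)"
    using e by (simp_all add: of_nat_diff)
  have c: "c i = coeff (of_nat (Suc d) * ([:disc a:] * of_nat d * (qpoly a ^ (d - 1) * qpoly (axis i 1))
       + of_nat (2 * d + 1) * [:log_deriv_numerator i a:] * qpoly a ^ d)) e" for i
    unfolding c_def by (simp only: of_nat_poly) (simp add: algebra_simps)
  have "c 0 = coeff ([:0, 1:] * pderiv (pderiv H) - of_nat (2 * d + 1) * pderiv H) e"
    using ode(1) unfolding c qpoly_axis log_deriv_numerator_def H_def by simp
  then show "c 0 = - of_nat (Suc e) * of_nat (2 * d + 1 - e) * coeff (qpoly a ^ Suc d) (Suc e)"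
    unfolding k coeff_diff coeff_of_nat_mult coeff_X_mult_pderiv coeff_pderiv H_def[symmetric]
    by (simp add: algebra_simps)
  have "c 1 = coeff (- (of_nat (2 * d + 2) * (of_nat (2 * d + 1) * H) - of_nat 2 * (of_nat (2 * d + 1) * ([:0, 1:] * pderiv H))
               + [:0, 1:] * [:0, 1:] * pderiv (pderiv H))) e"
    using ode(2) unfolding c qpoly_axis log_deriv_numerator_def H_def
    by (simp add: algebra_simps)
  then show "c 1 = - of_nat (2 * d + 2 - e) * of_nat (2 * d + 1 - e) * coeff (qpoly a ^ Suc d) e"
    unfolding k coeff_diff coeff_add coeff_minus coeff_of_nat_mult coeff_X_mult_pderiv coeff_X_sq_mult_pderiv2 H_def[symmetric]
    by (simp add: algebra_simps)
  have "c 2 = coeff (- pderiv (pderiv H)) e"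
    using ode(3) unfolding c qpoly_axis log_deriv_numerator_def H_def by simp
  then show "c 2 = - of_nat (Suc e) * of_nat (Suc (Suc e)) * coeff (qpoly a ^ Suc d) (Suc (Suc e))"
    unfolding coeff_minus coeff_pderiv H_def[symmetric] by (simp add: algebra_simps)
qed

text \<open>The scalars of \<open>coeff_qpoly_power_rec\<close> are exactly what raises
  \<open>e! (2d - e)!\<close> to the factorials for \<open>Suc d\<close> and
  \<open>e + weight i\<close>.\<close>

lemma deriv_numerator_rec:
  assumes "e \<le> 2 * d"
  shows "disc a * ((-1) ^ d * fact e * fact (2 * d - e) / fact d *
             (of_nat d * coeff (qpoly a ^ (d - 1) * qpoly (axis i 1)) e))
           + of_nat (2 * d + 1) * log_deriv_numerator i a * deriv_numerator d e a = deriv_numerator (Suc d) (e + weight i) a"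
proof -
  define c where "c = of_nat (Suc d) * (disc a * of_nat d * coeff (qpoly a ^ (d - 1) * qpoly (axis i 1)) e
                 + of_nat (2 * d + 1) * log_deriv_numerator i a * coeff (qpoly a ^ d) e)"
  have "disc a * ((-1) ^ d * fact e * fact (2 * d - e) / fact d *
             (of_nat d * coeff (qpoly a ^ (d - 1) * qpoly (axis i 1)) e))
           + of_nat (2 * d + 1) * log_deriv_numerator i a * deriv_numerator d e a
       = (-1) ^ d * fact e * fact (2 * d - e) / fact (Suc d) * c"
    unfolding c_def deriv_numerator_def by (simp add: divide_simps del: of_nat_Suc of_nat_add of_nat_mult) (simp add: algebra_simps)
  also have "\<dots> = deriv_numerator (Suc d) (e + weight i) a"
  proof -
    obtain k where k: "2 * d = e + k" using assms le_Suc_ex by blast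
    have k': "2 * d - e = k" "2 * d + 1 - e = Suc k" "2 * d + 2 - e = Suc (Suc k)"
      "2 * Suc d - e = Suc (Suc k)" "2 * Suc d - Suc e = Suc k" "2 * Suc d - Suc (Suc e) = k"
      using k by simp_all
    note r = coeff_qpoly_power_rec[OF assms, of a, unfolded k']
    define h where "h = coeff (qpoly a ^ Suc d)"
    have f: "fact (Suc n) = (of_nat (Suc n) * fact n :: complex)" for n by simp
    consider "i = 0" "e + weight i = Suc e" | "i = 1" "e + weight i = e" | "i = 2" "e + weight i = Suc (Suc e)"
      using index3_cases[of i] by (auto simp: weight_def)
    then show ?thesis
    proof cases
      case 1
      show ?thesis
        unfolding 1(2) unfolding c_def deriv_numerator_def 1(1) r k' h_def[symmetric] f
        by (simp del: of_nat_Suc)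
    next
      case 2
      show ?thesis
        unfolding 2(2) unfolding c_def deriv_numerator_def 2(1) r k' h_def[symmetric] f
        by (simp del: of_nat_Suc)
    next
      case 3
      show ?thesis
        unfolding 3(2) unfolding c_def deriv_numerator_def 3(1) r k' h_def[symmetric] f
        by (simp del: of_nat_Suc)
    qed
  qed
  finally show ?thesis .
qed

section \<open>Differentiation along the coordinate axes\<close>

lemma DERIV_coeff_power:
  fixes p q :: "complex poly"
  shows "((\<lambda>z. coeff ((p + smult z q) ^ n) e) has_field_derivative
           of_nat n * coeff (p ^ (n - 1) * q) e) (at 0)"
proof (induction n arbitrary: e)
  case (Suc n)
  have lin: "((\<lambda>z. coeff (p + smult z q) i) has_field_derivative coeff q i) (at 0)" for i
    by (auto intro!: derivative_eq_intros)
  have "((\<lambda>z. \<Sum>i\<le>e. coeff (p + smult z q) i * coeff ((p + smult z q) ^ n) (e - i)) has_field_derivative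
      (\<Sum>i\<le>e. coeff q i * coeff (p ^ n) (e - i) + coeff p i * (of_nat n * coeff (p ^ (n - 1) * q) (e - i)))) (at 0)"
    by (rule DERIV_sum) (rule derivative_eq_intros lin Suc.IH refl | simp)+
  moreover have "(\<Sum>i\<le>e. coeff q i * coeff (p ^ n) (e - i) + coeff p i * (of_nat n * coeff (p ^ (n - 1) * q) (e - i)))
      = coeff (q * p ^ n) e + of_nat n * coeff (p * (p ^ (n - 1) * q)) e"
    by (simp add: coeff_mult sum.distrib sum_distrib_left algebra_simps)
  moreover have "\<dots> = of_nat (Suc n) * coeff (p ^ (Suc n - 1) * q) e"
    by (cases n) (simp_all add: algebra_simps)
  ultimately show ?case
    by (simp only: power_Suc coeff_mult)
qed simp

lemma bounded_linear_axis: "bounded_linear (axis i :: complex \<Rightarrow> form)"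
  by (intro linear_conv_bounded_linear[THEN iffD1] linearI) (auto simp: axis_def vec_eq_iff)

lemma axis_zero: "axis i 0 = 0"
  by (simp add: vec_eq_iff axis_def)

lemma qpoly_add_axis: "qpoly (a + axis i z) = qpoly a + smult z (qpoly (axis i 1))"
  by (simp add: qpoly_def axis_def)

lemma DERIV_deriv_numerator:
  "((\<lambda>z. deriv_numerator d e (a + axis i z)) has_field_derivative
     (-1) ^ d * fact e * fact (2 * d - e) / fact d *
     (of_nat d * coeff (qpoly a ^ (d - 1) * qpoly (axis i 1)) e)) (at 0)"
  unfolding deriv_numerator_def qpoly_add_axis
  by (intro DERIV_cmult DERIV_coeff_power)

lemma DERIV_disc:
  "((\<lambda>z. disc (a + axis i z)) has_field_derivative - 2 * log_deriv_numerator i a) (at 0)"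
proof -
  have "disc (a + axis i z) = (a $ 0 + (if i = 0 then z else 0))\<^sup>2
      - 4 * (a $ 1 + (if i = 1 then z else 0)) * (a $ 2 + (if i = 2 then z else 0))" for z
    by (simp add: disc_def axis_def)
  then show ?thesis
    using index3_cases[of i]
    by (auto simp: log_deriv_numerator_def intro!: derivative_eq_intros)
qed

text \<open>Complex homogeneity of \<open>L\<close> turns the real derivative into a complex one, so
  that the \<open>deriv\<close> in \<open>pd\<close> is a genuine derivative.\<close>

lemma holo_on_DERIV_axis:
  assumes "holo_on s U" "a \<in> U"
  shows "((\<lambda>z. s (a + axis i z)) has_field_derivative pd i s a) (at 0)"
proof -
  obtain L where L: "(s has_derivative L) (at a)" "\<And>c v. L (c *s v) = c * L v"
    using assms unfolding holo_on_def by blast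
  have ax: "((\<lambda>z. a + axis i z) has_derivative (axis i)) (at (0 :: complex))"
    using has_derivative_add[OF has_derivative_const bounded_linear_imp_has_derivative[OF bounded_linear_axis]]
    by simp
  have "((\<lambda>z. s (a + axis i z)) has_derivative (\<lambda>z. L (axis i z))) (at 0)"
    using has_derivative_compose[OF ax, of s L] L(1) by (simp add: axis_zero)
  moreover have "(\<lambda>z. L (axis i z)) = (*) (L (axis i 1))"
  proof
    fix z :: complex
    have "z *s axis i 1 = axis i z" by (simp add: vec_eq_iff axis_def)
    then show "L (axis i z) = L (axis i 1) * z" using L(2)[of z "axis i 1"] by simp
  qed
  ultimately have "((\<lambda>z. s (a + axis i z)) has_field_derivative L (axis i 1)) (at 0)"
    by (simp only: has_field_derivative_def)
  then show ?thesis
    unfolding pd_def by (simp add: DERIV_imp_deriv)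
qed

section \<open>Derivatives of solutions\<close>

text \<open>The first-order equations are linear in the three partial derivatives; elimination
  leaves the factor \<open>disc\<close>.\<close>

lemma sol_pd:
  assumes "s \<in> sol U" "a \<in> U"
  shows "disc a * pd i s a = log_deriv_numerator i a * s a"
proof -
  define p where "p = (\<lambda>i. pd i s a)"
  have eqs: "- 2 * (a $ 2) * p 0 - (a $ 0) * p 1 = 0" "- 2 * (a $ 1) * p 0 - (a $ 0) * p 2 = 0"
      "- 2 * (a $ 1) * p 1 + 2 * (a $ 2) * p 2 = 0"
      "(a $ 0) * p 0 + (a $ 1) * p 1 + (a $ 2) * p 2 + s a = 0"
    using assms unfolding sol_def p_def by blast+
  have "disc a * p 0 = - (a $ 0) * s a" "disc a * p 1 = 2 * a $ 2 * s a" "disc a * p 2 = 2 * a $ 1 * s a"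
    unfolding disc_def using eqs by algebra+
  then show ?thesis
    using index3_cases[of i] by (auto simp: log_deriv_numerator_def p_def)
qed

lemma pd_deriv_numerator:
  assumes s: "s \<in> sol U" and U: "open U" "U \<subseteq> B" and e: "e \<le> 2 * d"
    and f: "\<And>a. a \<in> U \<Longrightarrow> f a = deriv_numerator d e a * s a / disc a ^ d" and a: "a \<in> U"
  shows "pd i f a = deriv_numerator (Suc d) (e + weight i) a * s a / disc a ^ Suc d"
proof -
  have nz: "disc a \<noteq> 0"
    using a U(2) by (auto simp: B_def disc_def)
  have "isCont (\<lambda>z. a + axis i z) (0 :: complex)"
    by (intro continuous_intros linear_continuous_at bounded_linear_axis)
  then have ev: "\<forall>\<^sub>F z in nhds 0. a + axis i z \<in> U"
    using U(1) a by (simp add: isCont_def eventually_nhds_conv_at tendsto_def axis_zero)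
  define c where "c = (-1) ^ d * fact e * fact (2 * d - e) / fact d *
     (of_nat d * coeff (qpoly a ^ (d - 1) * qpoly (axis i 1)) e)"
  have dp: "((\<lambda>z. deriv_numerator d e (a + axis i z)) has_field_derivative c) (at 0)"
    unfolding c_def by (rule DERIV_deriv_numerator)
  have ds: "((\<lambda>z. s (a + axis i z)) has_field_derivative log_deriv_numerator i a * s a / disc a) (at 0)"
  proof -
    have "pd i s a = log_deriv_numerator i a * s a / disc a"
      using sol_pd[OF s a, of i] nz by (simp add: field_simps)
    then show ?thesis
      using holo_on_DERIV_axis[of s U a i] s a by (simp add: sol_def)
  qed
  \<comment> \<open>In \<open>2 * d + 1\<close>, the 1 comes from \<open>s\<close> and
    \<open>2 * d\<close> from \<open>1 / disc^d\<close>, by \<open>DERIV_disc\<close>.\<close>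
  have "((\<lambda>z. deriv_numerator d e (a + axis i z) * s (a + axis i z) / disc (a + axis i z) ^ d) has_field_derivative
      ((disc a * c + of_nat (2 * d + 1) * log_deriv_numerator i a * deriv_numerator d e a) * s a / disc a ^ Suc d)) (at 0)"
  proof (cases d)
    case 0
    show ?thesis
      by (rule derivative_eq_intros dp ds DERIV_disc refl)+
         (use nz 0 in \<open>simp_all add: axis_zero field_simps\<close>)
  next
    case (Suc n)
    show ?thesis
      by (rule derivative_eq_intros dp ds DERIV_disc refl)+
         (use nz in \<open>simp_all add: axis_zero Suc field_simps\<close>)
  qed
  then have "((\<lambda>z. f (a + axis i z)) has_field_derivative
      ((disc a * c + of_nat (2 * d + 1) * log_deriv_numerator i a * deriv_numerator d e a) * s a / disc a ^ Suc d)) (at 0)"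
    by (subst DERIV_cong_ev[OF refl _ refl]) (use ev f in \<open>auto elim!: eventually_mono\<close>)
  then show ?thesis
    unfolding pd_def by (simp only: DERIV_imp_deriv c_def deriv_numerator_rec[OF e])
qed

lemma pd_funpow_deriv_numerator:
  assumes s: "s \<in> sol U" and U: "open U" "U \<subseteq> B" and e: "e \<le> 2 * d"
    and f: "\<And>a. a \<in> U \<Longrightarrow> f a = deriv_numerator d e a * s a / disc a ^ d" and a: "a \<in> U"
  shows "(pd i ^^ n) f a = deriv_numerator (d + n) (e + n * weight i) a * s a / disc a ^ (d + n)"
  using a
proof (induction n arbitrary: a)
  case (Suc n)
  \<comment> \<open>Weights are at most 2, so the bound on \<open>e\<close> survives each
    derivative.\<close>
  have "e + n * weight i \<le> 2 * d + n * 2"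
    using e by (intro add_le_mono mult_le_mono2) (auto simp: weight_def)
  then have "e + n * weight i \<le> 2 * (d + n)" by simp
  from pd_deriv_numerator[OF s U this Suc.IH Suc.prems, of i] show ?case
    by (simp add: algebra_simps)
qed (use f in simp)

lemma monomial_op_deriv_numerator:
  fixes m :: "3 \<Rightarrow>\<^sub>0 nat"
  assumes s: "s \<in> sol U" and U: "open U" "U \<subseteq> B" and a: "a \<in> U"
  defines "d \<equiv> \<Sum>i\<in>UNIV. Poly_Mapping.lookup m i"
  shows "monomial_op m s a =
    deriv_numerator d (Poly_Mapping.lookup m 0 + 2 * Poly_Mapping.lookup m 2) a * s a / disc a ^ d"
proof -
  let ?m = "Poly_Mapping.lookup m"
  have d: "d = ?m 2 + ?m 1 + ?m 0"
    unfolding d_def by (simp add: sum_UNIV_index3)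
  \<comment> \<open>The iteration starts from \<open>s\<close> itself, since
    \<open>deriv_numerator 0 0\<close> is 1.\<close>
  have 2: "(pd 2 ^^ ?m 2) s a = deriv_numerator (?m 2) (2 * ?m 2) a * s a / disc a ^ ?m 2" if "a \<in> U" for a
    using pd_funpow_deriv_numerator[OF s U, where e = 0 and d = 0 and f = s and a = a and i = 2 and n = "?m 2"] that by (simp add: deriv_numerator_def weight_def mult.commute)
  have 1: "(pd 1 ^^ ?m 1) ((pd 2 ^^ ?m 2) s) a =
      deriv_numerator (?m 2 + ?m 1) (2 * ?m 2) a * s a / disc a ^ (?m 2 + ?m 1)" if "a \<in> U" for a
    using pd_funpow_deriv_numerator[OF s U _ 2 that, where i = 1 and n = "?m 1"] by (simp add: weight_def)
  show ?thesis
    unfolding monomial_op_def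
    using pd_funpow_deriv_numerator[OF s U _ 1 a, where i = 0 and n = "?m 0"] by (simp add: weight_def d add.commute)
qed

section \<open>Zeros of linear combinations of coefficients of \<open>Q^d\<close>\<close>

lemma exists_form_coeff_functional_zero:
  fixes r :: "nat \<Rightarrow> complex"
  assumes d: "d > 0"
  shows "\<exists>b\<in>B. (\<Sum>e\<le>2 * d. r e * coeff (qpoly b ^ d) e) = 0"
proof -
  consider k where "k \<in> {1..d}" "r (d + k) \<noteq> 0" | k where "k \<in> {1..d}" "r (d - k) \<noteq> 0"
    | "\<And>e. e \<le> 2 * d \<Longrightarrow> e \<noteq> d \<Longrightarrow> r e = 0"
  proof -
    have "\<exists>k\<in>{1..d}. e = d + k \<or> e = d - k" if "e \<le> 2 * d" "e \<noteq> d" for e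
    proof (cases "e < d")
      case True
      then show ?thesis by (intro bexI[of _ "d - e"]) auto
    next
      case False
      then show ?thesis using that by (intro bexI[of _ "e - d"]) auto
    qed
    then show ?thesis using that by blast
  qed
  then show ?thesis
  proof cases
    case 1
    define c where "c = (\<lambda>i. r (d + i) * of_nat (d choose i))"
    have "c k \<noteq> 0" using 1 by (simp add: c_def)
    then obtain z where z: "(\<Sum>i\<le>d. c i * z ^ i) = 0"
      using fundamental_theorem_of_algebra[of c d] 1(1) by blast
    \<comment> \<open>The sign gives \<open>Q = t (1 + z t)\<close>, whose powers have binomial
      coefficients.\<close>
    define b where "b = (axis 0 1 + axis 1 (- z) :: form)"
    have q: "qpoly b ^ d = monom 1 d * [:1, z:] ^ d"
    proof -
      have "qpoly b = monom 1 1 * [:1, z:]"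
        by (simp add: b_def qpoly_def axis_def monom_altdef)
      then show ?thesis by (simp only: power_mult_distrib monom_power) simp
    qed
    have "(\<Sum>e\<le>2 * d. r e * coeff (qpoly b ^ d) e) = (\<Sum>e\<in>{d..2 * d}. r e * coeff (qpoly b ^ d) e)"
      by (rule sum.mono_neutral_right) (auto simp: q coeff_monom_mult)
    also have "\<dots> = (\<Sum>i\<le>d. r (d + i) * coeff (qpoly b ^ d) (d + i))"
      by (rule sum.reindex_bij_witness[of _ "\<lambda>i. d + i" "\<lambda>e. e - d"]) auto
    also have "\<dots> = (\<Sum>i\<le>d. c i * z ^ i)"
      by (rule sum.cong) (auto simp: q coeff_monom_mult coeff_linear_poly_power c_def)
    finally have "(\<Sum>e\<le>2 * d. r e * coeff (qpoly b ^ d) e) = 0" using z by simp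
    moreover have "b \<in> B" by (simp add: B_def b_def axis_def)
    ultimately show ?thesis by blast
  next
    case 2
    define c where "c = (\<lambda>i. r (d - i) * of_nat (d choose (d - i)))"
    have "c k \<noteq> 0" using 2 by (simp add: c_def)
    then obtain z where z: "(\<Sum>i\<le>d. c i * z ^ i) = 0"
      using fundamental_theorem_of_algebra[of c d] 2(1) by blast
    define b where "b = (axis 0 1 + axis 2 (- z) :: form)"
    have q: "qpoly b = [:z, 1:]"
      by (simp add: b_def qpoly_def axis_def)
    have "(\<Sum>e\<le>2 * d. r e * coeff (qpoly b ^ d) e) = (\<Sum>e\<le>d. r e * coeff (qpoly b ^ d) e)"
      by (rule sum.mono_neutral_right) (auto simp: q intro!: coeff_eq_0 simp: degree_linear_power)
    also have "\<dots> = (\<Sum>i\<le>d. r (d - i) * coeff (qpoly b ^ d) (d - i))"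
      by (rule sum.reindex_bij_witness[of _ "\<lambda>i. d - i" "\<lambda>e. d - e"]) auto
    also have "\<dots> = (\<Sum>i\<le>d. c i * z ^ i)"
      by (rule sum.cong) (auto simp: q coeff_linear_poly_power c_def)
    finally have "(\<Sum>e\<le>2 * d. r e * coeff (qpoly b ^ d) e) = 0" using z by simp
    moreover have "b \<in> B" by (simp add: B_def b_def axis_def)
    ultimately show ?thesis by blast
  next
    case 3
    \<comment> \<open>\<open>c k\<close> is the coefficient of \<open>z^k\<close> in the
      \<open>t^d\<close> coefficient of \<open>(z t - (1 + t^2))^d\<close>.\<close>
    define c where "c = (\<lambda>k. of_nat (d choose k) * coeff ([:- 1, 0, - 1:] ^ (d - k) :: complex poly) (d - k))"
    have "c d \<noteq> 0" by (simp add: c_def)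
    then obtain z where z: "(\<Sum>i\<le>d. c i * z ^ i) = 0"
      using fundamental_theorem_of_algebra[of c d] d by fastforce
    define b where "b = (axis 0 z + axis 1 1 + axis 2 1 :: form)"
    have q: "qpoly b = [:- 1, z, - 1:]"
      by (simp add: b_def qpoly_def axis_def)
    have q': "qpoly b = monom z 1 + [:- 1, 0, - 1:]"
      by (simp add: q monom_altdef)
    have "coeff (qpoly b ^ d) d = (\<Sum>k\<le>d. c k * z ^ k)"
      unfolding q' binomial_ring coeff_sum
      by (rule sum.cong) (auto simp: monom_power of_nat_poly coeff_monom_mult c_def)
    then have coeff_d: "coeff (qpoly b ^ d) d = 0" using z by simp
    have "(\<Sum>e\<le>2 * d. r e * coeff (qpoly b ^ d) e) = 0"
      by (rule sum.neutral) (use 3 coeff_d in force)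
    moreover have "disc b \<noteq> 0"
    proof
      assume "disc b = 0"
      then have "z\<^sup>2 = 2\<^sup>2" by (simp add: disc_def b_def axis_def)
      then have "z = 2 \<or> z = - 2" by (simp only: power2_eq_iff)
      \<comment> \<open>Here \<open>Q = - (1 + u t)^2\<close>, so the middle coefficient is a
        central binomial coefficient up to a unit, contradicting \<open>coeff_d\<close>.\<close>
      then have "z = - 2 * (- z / 2)" "(- z / 2)\<^sup>2 = 1" by auto
      then obtain u where u: "z = - 2 * u" "u\<^sup>2 = 1" by blast
      have "qpoly b = smult (- 1) ([:1, u:]\<^sup>2)"
        using u by (simp add: q power2_eq_square)
      then have "coeff (qpoly b ^ d) d = (-1) ^ d * coeff ([:1, u:] ^ (2 * d)) d"
        by (simp only: smult_power power_mult) simp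
      then have "coeff (qpoly b ^ d) d = (-1) ^ d * (of_nat (2 * d choose d) * u ^ d)"
        by (simp add: coeff_linear_poly_power)
      moreover have "u \<noteq> 0" using u(2) by auto
      ultimately show False using coeff_d by simp
    qed
    then have "b \<in> B" by (simp add: B_def disc_def)
    ultimately show ?thesis by blast
  qed
qed

theorem proposition5p1:
  fixes d :: nat and \<delta> :: diffop
  assumes "d > 0" and "\<delta> \<in> homogeneous_ops d"
  shows "zero_locus \<delta> \<noteq> {}"
proof -
  let ?K = "Poly_Mapping.keys \<delta>" and ?c = "Poly_Mapping.lookup \<delta>"
  define ex where "ex m = Poly_Mapping.lookup m 0 + 2 * Poly_Mapping.lookup m 2" for m :: "3 \<Rightarrow>\<^sub>0 nat"
  \<comment> \<open>Monomials of equal weight act alike on solutions, so their coefficients are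
    pooled; \<open>r\<close> absorbs the factorials.\<close>
  define q where "q e = (\<Sum>m\<in>{m\<in>?K. ex m = e}. ?c m)" for e
  define r where "r e = q e * ((-1) ^ d * fact e * fact (2 * d - e) / fact d)" for e
  have deg: "(\<Sum>i\<in>UNIV. Poly_Mapping.lookup m i) = d" if "m \<in> ?K" for m
    using assms(2) that by (auto simp: homogeneous_ops_def)
  have ex_le: "ex m \<le> 2 * d" if "m \<in> ?K" for m
    using deg[OF that] by (simp add: ex_def sum_UNIV_index3)
  obtain b where b: "b \<in> B"
    and zero: "(\<Sum>e\<le>2 * d. r e * coeff (qpoly b ^ d) e) = 0"
    using exists_form_coeff_functional_zero[OF assms(1), of r] by blast
  have "(\<Sum>m\<in>?K. ?c m * deriv_numerator d (ex m) b) = (\<Sum>e\<le>2 * d. \<Sum>m\<in>{m\<in>?K. ex m = e}. ?c m * deriv_numerator d (ex m) b)"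
    by (rule sum.group[symmetric]) (use ex_le in auto)
  also have "\<dots> = (\<Sum>e\<le>2 * d. q e * deriv_numerator d e b)"
    by (simp add: q_def sum_distrib_right)
  also have "\<dots> = 0"
    using zero by (simp add: deriv_numerator_def r_def mult.assoc)
  finally have sum0: "(\<Sum>m\<in>?K. ?c m * deriv_numerator d (ex m) b) = 0" .
  have "open B"
    unfolding B_def by (intro open_Collect_neq continuous_intros)
  have "apply_op \<delta> s b = 0" if "s \<in> sol_stalk b" for s
  proof -
    obtain U where U: "open U" "b \<in> U" "s \<in> sol U"
      using \<open>s \<in> sol_stalk b\<close> by (auto simp: sol_stalk_def)
    \<comment> \<open>Intersecting with \<open>B\<close> keeps \<open>disc\<close> nonzero
      throughout the neighbourhood.\<close>
    have "s \<in> sol (U \<inter> B)" using U(3) by (auto simp: sol_def holo_on_def)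
    then have "monomial_op m s b = deriv_numerator d (ex m) b * s b / disc b ^ d" if "m \<in> ?K" for m
      using monomial_op_deriv_numerator[of s "U \<inter> B" b m] U \<open>open B\<close> b deg[OF that] by (auto simp: ex_def)
    then have "apply_op \<delta> s b = (\<Sum>m\<in>?K. ?c m * deriv_numerator d (ex m) b) * s b / disc b ^ d"
      unfolding apply_op_def sum_distrib_right sum_divide_distrib by (intro sum.cong) auto
    then show ?thesis using sum0 by simp
  qed
  then show ?thesis
    using b by (auto simp: zero_locus_def)
qed

end
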